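(* Let $Z_1,\dots,Z_n$ be independent symmetric random variables with values in $[-1,1]$ and with average variance $\sigma^2=\frac1n\sum_{i=1}^n\mathbb{V}[Z_i]$. Then for any positive even integer $d$, $$\Bigl\|\sum_{i=1}^n Z_i\Bigr\|_d\leqslant \Bigl\|\sum_{i=1}^n Z_i'\Bigr\|_d,$$ where $Z_1',\dots,Z_n'$ are independent and identically distributed, each taking the value $+1$ with probability $\sigma^2/2$, the value $0$ with probability $1-\sigma^2$, and the value $-1$ with probability $\sigma^2/2$.
   Context: For a real random variable $Z$, $\|Z\|_d=(\mathbb{E}|Z|^d)^{1/d}$ and $\mathbb{V}[Z]$ is its variance. A random variable $Z$ is symmetric if $Z$ and $-Z$ have the same distribution. The $Z_i$ need not be identically distributed. *)

theory Defs
  imports "HOL-Probability.Probability"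
begin

definition Lnorm :: "'a measure \<Rightarrow> nat \<Rightarrow> ('a \<Rightarrow> real) \<Rightarrow> real" where
  "Lnorm M d Z = (prob_space.expectation M (\<lambda>x. \<bar>Z x\<bar> ^ d)) powr (1 / real d)"

definition symmetric_rv :: "'a measure \<Rightarrow> ('a \<Rightarrow> real) \<Rightarrow> bool" where
  "symmetric_rv M Z \<longleftrightarrow> distr M borel Z = distr M borel (\<lambda>x. - Z x)"

end

theory Submission
  imports Defs "HOL-Computational_Algebra.Formal_Power_Series"
begin

unbundle no vec_syntax
unbundle fps_syntax

text \<open>
  Compare the formal moment generating functions coefficientwise. Independence turns sums into
  products, symmetry and boundedness bound the \<open>i\<close>-th factor by \<open>1 + p\<^sub>i C\<close> with \<open>C = cosh - 1\<close> and
  \<open>p\<^sub>i\<close> the variance of \<open>Z\<^sub>i\<close>, and \<open>1 + \<sigma>\<^sup>2 C\<close> is the exact factor of \<open>Z'\<^sub>i\<close>. As \<open>C\<close> has nonnegative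
  coefficients, it remains to see that averaging the \<open>p\<^sub>i\<close> increases the product; this is a
  smoothing argument in the style of Maclaurin's inequality.
\<close>

section \<open>Coefficientwise inequalities between power series\<close>

lemma fps_mult_nth_nonneg:
  fixes f g :: "'a::linordered_semidom fps"
  assumes "\<And>k. 0 \<le> f $ k" and "\<And>k. 0 \<le> g $ k"
  shows "0 \<le> (f * g) $ k"
  using assms by (auto simp: fps_mult_nth intro!: sum_nonneg)

text \<open>Every summand of the Cauchy product is monotone when the smaller factors have
  nonnegative coefficients; hence the nonnegativity facts that accompany each comparison
  below.\<close>

lemma fps_mult_nth_mono:
  fixes f g :: "'a::linordered_semidom fps"
  assumes "\<And>k. 0 \<le> f $ k" and "\<And>k. f $ k \<le> f' $ k"
    and "\<And>k. 0 \<le> g $ k" and "\<And>k. g $ k \<le> g' $ k"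
  shows "(f * g) $ k \<le> (f' * g') $ k"
  unfolding fps_mult_nth using assms
  by (intro sum_mono mult_mono) (auto intro: order_trans)

lemma fps_prod_nth_nonneg:
  fixes f :: "'i \<Rightarrow> 'a::linordered_idom fps"
  assumes "\<And>i k. i \<in> S \<Longrightarrow> 0 \<le> f i $ k"
  shows "0 \<le> (\<Prod>i\<in>S. f i) $ k"
  using assms
  by (induction S arbitrary: k rule: infinite_finite_induct) (auto intro!: fps_mult_nth_nonneg)

lemma fps_prod_nth_mono:
  fixes f :: "'i \<Rightarrow> 'a::linordered_idom fps"
  assumes "\<And>i k. i \<in> S \<Longrightarrow> 0 \<le> f i $ k" and "\<And>i k. i \<in> S \<Longrightarrow> f i $ k \<le> g i $ k"
  shows "(\<Prod>i\<in>S. f i) $ k \<le> (\<Prod>i\<in>S. g i) $ k"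
  using assms
proof (induction S arbitrary: k rule: infinite_finite_induct)
  case (insert i S)
  then have "(f i * prod f S) $ k \<le> (g i * prod g S) $ k"
    by (intro fps_mult_nth_mono fps_prod_nth_nonneg) auto
  with insert show ?case by simp
qed auto

lemma fps_one_plus_const_mult_nth_nonneg:
  fixes C :: "real fps"
  assumes "\<And>k. 0 \<le> C $ k" and "0 \<le> a"
  shows "0 \<le> (1 + fps_const a * C) $ k"
  using assms by simp

text \<open>Both pairs of parameters have the sum \<open>a + b\<close>, so before multiplying by
  \<open>R\<close> the products differ only in the term with \<open>C * C\<close>, where m (a + b -
  m) - a b = (m - a) (b - m).\<close>

lemma fps_smoothing_nth_le:
  fixes C :: "real fps"
  assumes C: "\<And>k. 0 \<le> C $ k" and R: "\<And>k. 0 \<le> R $ k" and ab: "a \<le> m" "m \<le> b"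
  shows "((1 + fps_const a * C) * ((1 + fps_const b * C) * R)) $ k
       \<le> ((1 + fps_const m * C) * ((1 + fps_const (a + b - m) * C) * R)) $ k"
proof -
  have "(1 + fps_const m * C) * ((1 + fps_const (a + b - m) * C) * R)
      - (1 + fps_const a * C) * ((1 + fps_const b * C) * R)
      = fps_const ((m - a) * (b - m)) * (C * C * R)"
    by (simp add: algebra_simps flip: fps_const_add fps_const_sub fps_const_mult)
  moreover have "0 \<le> (fps_const ((m - a) * (b - m)) * (C * C * R)) $ k"
    using ab by (auto intro!: mult_nonneg_nonneg fps_mult_nth_nonneg C R)
  ultimately show ?thesis by (metis diff_ge_0_iff_ge fps_sub_nth)
qed

text \<open>Induction on the number of factors. Unless all parameters equal the mean
  \<open>m\<close>, one lies below it and one above. Smoothing this pair to \<open>m\<close> and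
  \<open>p i + p j - m\<close> splits off a factor with parameter \<open>m\<close> and leaves one
  parameter fewer, with the same mean.\<close>

lemma fps_prod_one_plus_nth_le_power:
  fixes C :: "real fps" and p :: "'i \<Rightarrow> real"
  assumes C: "\<And>k. 0 \<le> C $ k" and "finite S" and "\<And>i. i \<in> S \<Longrightarrow> 0 \<le> p i"
    and "sum p S = real (card S) * m"
  shows "(\<Prod>i\<in>S. 1 + fps_const (p i) * C) $ k \<le> ((1 + fps_const m * C) ^ card S) $ k"
  using assms(2-)
proof (induction "card S" arbitrary: S p k)
  case 0
  then show ?case by simp
next
  case (Suc n)
  let ?F = "\<lambda>a. 1 + fps_const a * C"
  show ?case
  proof (cases "\<forall>i\<in>S. p i = m")
    case True
    then have "(\<Prod>i\<in>S. ?F (p i)) = (\<Prod>i\<in>S. ?F m)" by (intro prod.cong) auto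
    then show ?thesis by simp
  next
    case False
    have m_sum: "sum p S = (\<Sum>i\<in>S. m)" using Suc.prems(3) by simp
    \<comment> \<open>With no parameter below \<open>m\<close> and some different from
      \<open>m\<close>, the sum would strictly exceed that of the constant \<open>m\<close>. The
      next step is the mirror image.\<close>
    obtain i where i: "i \<in> S" "p i < m"
      using False sum_strict_mono_ex1[of S "\<lambda>_. m" p] Suc.prems(1) m_sum
      by (metis less_irrefl linorder_neqE_linordered_idom not_le)
    obtain j where j: "j \<in> S" "m < p j"
      using False sum_strict_mono_ex1[of S p "\<lambda>_. m"] Suc.prems(1) m_sum
      by (metis less_irrefl linorder_neqE_linordered_idom not_le)
    have "i \<noteq> j" using i j by auto
    define U where "U = S - {i}"
    \<comment> \<open>The deficit \<open>m - p i\<close> of the dropped index is charged to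
      \<open>j\<close>, so the mean over \<open>U\<close> is again \<open>m\<close>. The new value
      is nonnegative since \<open>m < p j\<close> and \<open>0 \<le> p i\<close>.\<close>
    define r where "r = p(j := p i + p j - m)"
    have fin: "finite U" "finite (U - {j})" and jU: "j \<in> U" and SU: "S = insert i U" "i \<notin> U"
      using Suc.prems(1) i j \<open>i \<noteq> j\<close> by (auto simp: U_def)
    have cardU: "n = card U" using Suc.hyps(2) SU fin by simp
    have split: "(\<Prod>l\<in>U. ?F (h l)) = ?F (h j) * (\<Prod>l\<in>U - {j}. ?F (h l))" for h
      using fin jU by (subst prod.remove[of _ j]) auto
    have eq: "(\<Prod>l\<in>U - {j}. ?F (r l)) = (\<Prod>l\<in>U - {j}. ?F (p l))"
      by (intro prod.cong) (auto simp: r_def)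
    have r_nonneg: "0 \<le> r l" if "l \<in> U" for l
      using that i j Suc.prems(2)[of i] Suc.prems(2)[of l] SU by (auto simp: r_def)
    have m_nonneg: "0 \<le> m" using i Suc.prems(2) by force
    have "sum r U = r j + sum r (U - {j})" using fin jU by (simp add: sum.remove)
    also have "sum r (U - {j}) = sum p (U - {j})"
      by (intro sum.cong) (auto simp: r_def)
    also have "r j + sum p (U - {j}) = sum p S - m"
      using fin jU SU by (simp add: r_def sum.remove[of U j p])
    also have "\<dots> = real (card U) * m"
      using Suc.prems(3) cardU by (simp add: algebra_simps flip: Suc.hyps(2))
    finally have r_sum: "sum r U = real (card U) * m" .
    have "(\<Prod>l\<in>S. ?F (p l)) $ k = (?F (p i) * (?F (p j) * (\<Prod>l\<in>U - {j}. ?F (p l)))) $ k"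
      using SU fin by (simp add: split)
    also have "\<dots> \<le> (?F m * (?F (p i + p j - m) * (\<Prod>l\<in>U - {j}. ?F (p l)))) $ k"
      using i j Suc.prems(2) SU
      by (intro fps_smoothing_nth_le fps_prod_nth_nonneg fps_one_plus_const_mult_nth_nonneg C) auto
    also have "\<dots> = (?F m * (\<Prod>l\<in>U. ?F (r l))) $ k"
      by (simp only: split eq) (simp add: r_def)
    also have "\<dots> \<le> (?F m * ?F m ^ card U) $ k"
      using Suc.hyps(1)[OF cardU fin(1) r_nonneg r_sum]
      by (intro fps_mult_nth_mono fps_prod_nth_nonneg fps_one_plus_const_mult_nth_nonneg
          C m_nonneg r_nonneg order_refl) auto
    also have "?F m * ?F m ^ card U = ?F m ^ card S"
      using Suc.hyps(2) cardU by (metis power_Suc)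
    finally show ?thesis .
  qed
qed

section \<open>Formal moment generating functions\<close>

text \<open>The expectation of exp(t X), expanded formally in t, so that no convergence question
  arises.\<close>

definition moment_fps :: "'a measure \<Rightarrow> ('a \<Rightarrow> real) \<Rightarrow> real fps" where
  "moment_fps M X = Abs_fps (\<lambda>k. (LINT x|M. X x ^ k) / fact k)"

lemma moment_fps_nth [simp]: "moment_fps M X $ k = (LINT x|M. X x ^ k) / fact k"
  by (simp add: moment_fps_def)

context prob_space
begin

lemma integrable_power_bounded:
  fixes X :: "'a \<Rightarrow> real"
  assumes "X \<in> borel_measurable M" and "AE x in M. \<bar>X x\<bar> \<le> B"
  shows "integrable M (\<lambda>x. X x ^ k)"
proof (rule integrable_const_bound)
  show "AE x in M. norm (X x ^ k) \<le> B ^ k"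
    using assms(2) by eventually_elim (auto simp: power_abs intro!: power_mono)
qed (use assms in measurable)

text \<open>Expand by the binomial theorem and factor each mixed moment by independence; dividing by
  \<open>fact k\<close> turns the binomial convolution into the Cauchy product.\<close>

lemma moment_fps_add:
  fixes X Y :: "'a \<Rightarrow> real"
  assumes indep: "indep_var borel X borel Y"
    and X: "\<And>k. integrable M (\<lambda>x. X x ^ k)" and Y: "\<And>k. integrable M (\<lambda>x. Y x ^ k)"
  shows "moment_fps M (\<lambda>x. X x + Y x) = moment_fps M X * moment_fps M Y"
proof (rule fps_ext)
  fix k
  have ind: "indep_var borel (\<lambda>x. X x ^ a) borel (\<lambda>x. Y x ^ b)" for a b
    using indep_var_compose[OF indep, of "\<lambda>t. t ^ a" borel "\<lambda>t. t ^ b" borel]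
    by (simp add: comp_def)
  note prod = indep_var_lebesgue_integral[OF ind X Y] indep_var_integrable[OF ind X Y]
  have "(LINT x|M. (X x + Y x) ^ k)
      = (LINT x|M. (\<Sum>j\<le>k. real (k choose j) * (X x ^ j * Y x ^ (k - j))))"
    by (simp add: binomial_ring mult.assoc)
  also have "\<dots> = (\<Sum>j\<le>k. real (k choose j) * ((LINT x|M. X x ^ j) * (LINT x|M. Y x ^ (k - j))))"
    by (subst Bochner_Integration.integral_sum) (auto simp: prod)
  also have "\<dots> / fact k
      = (\<Sum>j\<le>k. (LINT x|M. X x ^ j) / fact j * ((LINT x|M. Y x ^ (k - j)) / fact (k - j)))"
    by (auto simp: sum_divide_distrib binomial_fact intro!: sum.cong)
  finally show "moment_fps M (\<lambda>x. X x + Y x) $ k = (moment_fps M X * moment_fps M Y) $ k"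
    by (simp add: fps_mult_nth atLeast0AtMost)
qed

lemma moment_fps_sum:
  fixes X :: "'i \<Rightarrow> 'a \<Rightarrow> real"
  assumes "finite S" and "indep_vars (\<lambda>_. borel) X S"
    and "\<And>i. i \<in> S \<Longrightarrow> AE x in M. \<bar>X i x\<bar> \<le> B"
  shows "moment_fps M (\<lambda>x. \<Sum>i\<in>S. X i x) = (\<Prod>i\<in>S. moment_fps M (X i))"
  using assms
proof (induction S rule: finite_induct)
  case empty
  show ?case by (rule fps_ext) (simp add: power_0_left prob_space)
next
  case (insert i S)
  have meas: "X l \<in> borel_measurable M" if "l \<in> insert i S" for l
    using insert.prems(1) that by (auto simp: indep_vars_def)
  have "AE x in M. \<forall>l\<in>S. \<bar>X l x\<bar> \<le> B"
    using insert by (auto simp: AE_finite_all)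
  \<comment> \<open>This bound makes all powers of the partial sum integrable, as the two-variable
    case requires.\<close>
  then have bd: "AE x in M. \<bar>\<Sum>l\<in>S. X l x\<bar> \<le> (\<Sum>l\<in>S. B)"
    by eventually_elim (blast intro: order_trans[OF sum_abs] sum_mono)
  have "moment_fps M (\<lambda>x. X i x + (\<Sum>l\<in>S. X l x))
      = moment_fps M (X i) * moment_fps M (\<lambda>x. \<Sum>l\<in>S. X l x)"
    using insert meas
    by (intro moment_fps_add indep_vars_sum integrable_power_bounded[of _ B]
        integrable_power_bounded[OF _ bd]) auto
  moreover have "moment_fps M (\<lambda>x. \<Sum>l\<in>S. X l x) = (\<Prod>l\<in>S. moment_fps M (X l))"
    using insert by (auto intro: indep_vars_subset)
  ultimately show ?case using insert by simp
qed

section \<open>Moments of symmetric and of three-point variables\<close>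

lemma symmetric_rv_odd_moment:
  assumes "symmetric_rv M X" and [measurable]: "X \<in> borel_measurable M" and "odd k"
  shows "expectation (\<lambda>x. X x ^ k) = 0"
proof -
  have "expectation (\<lambda>x. X x ^ k) = (LINT t|distr M borel X. t ^ k)"
    by (simp add: integral_distr)
  also have "\<dots> = (LINT t|distr M borel (\<lambda>x. - X x). t ^ k)"
    using assms(1) by (simp add: symmetric_rv_def)
  also have "\<dots> = - expectation (\<lambda>x. X x ^ k)"
    using \<open>odd k\<close> by (simp add: integral_distr)
  finally show ?thesis by simp
qed

lemma symmetric_rv_variance:
  assumes "symmetric_rv M X" and "X \<in> borel_measurable M"
  shows "variance X = expectation (\<lambda>x. X x ^ 2)"
  using symmetric_rv_odd_moment[OF assms, of 1] by simp

end

text \<open>A three-point variable with variance v has all even moments of positive order equal to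
  v, which gives the series 1 + v (cosh t - 1).\<close>

definition cosh_minus_one_fps :: "real fps" where
  "cosh_minus_one_fps = Abs_fps (\<lambda>k. if even k \<and> k \<noteq> 0 then 1 / fact k else 0)"

lemma one_plus_cosh_nth:
  "(1 + fps_const p * cosh_minus_one_fps) $ k
    = (if k = 0 then 1 else if even k then p else 0) / fact k"
  by (simp add: cosh_minus_one_fps_def)

context prob_space
begin

text \<open>Odd moments vanish by symmetry, and on [-1,1] an even power of positive order is at most
  the square, whose expectation is the variance.\<close>

lemma symmetric_rv_moment_fps_nth:
  assumes sym: "symmetric_rv M X" and X: "X \<in> borel_measurable M"
    and bd: "AE x in M. X x \<in> {-1..1}"
  shows "0 \<le> moment_fps M X $ k"
    and "moment_fps M X $ k \<le> (1 + fps_const (variance X) * cosh_minus_one_fps) $ k"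
proof -
  have bd': "AE x in M. \<bar>X x\<bar> \<le> 1" using bd by eventually_elim auto
  note int = integrable_power_bounded[OF X bd']
  have nonneg: "0 \<le> expectation (\<lambda>x. X x ^ k)"
    using symmetric_rv_odd_moment[OF sym X]
    by (cases "even k") (auto intro!: integral_nonneg_AE simp: zero_le_even_power)
  show "0 \<le> moment_fps M X $ k" using nonneg by simp
  have "expectation (\<lambda>x. X x ^ k) \<le> expectation (\<lambda>x. X x ^ 2)" if "even k" "k \<noteq> 0"
  proof (intro integral_mono_AE int)
    have "2 \<le> k" using that by presburger
    show "AE x in M. X x ^ k \<le> X x ^ 2"
      using bd'
    proof eventually_elim
      case (elim x)
      then show ?case
        using power_decreasing[OF \<open>2 \<le> k\<close>, of "\<bar>X x\<bar>"] \<open>even k\<close> by (simp add: power_even_abs)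
    qed
  qed
  then show "moment_fps M X $ k \<le> (1 + fps_const (variance X) * cosh_minus_one_fps) $ k"
    unfolding one_plus_cosh_nth moment_fps_nth symmetric_rv_variance[OF sym X]
    using symmetric_rv_odd_moment[OF sym X]
    by (intro divide_right_mono) (auto simp: prob_space)
qed

text \<open>The three prescribed masses already add up to 1.\<close>

lemma three_point_AE:
  fixes Y :: "'a \<Rightarrow> real"
  assumes [measurable]: "Y \<in> borel_measurable M"
    and p: "prob {x \<in> space M. Y x = 1} = v / 2" "prob {x \<in> space M. Y x = 0} = 1 - v"
      "prob {x \<in> space M. Y x = -1} = v / 2"
  shows "AE x in M. Y x \<in> {-1, 0, 1}"
proof -
  let ?A = "\<lambda>c. {x \<in> space M. Y x = c}"
  have "prob (?A 1 \<union> ?A 0 \<union> ?A (-1)) = prob (?A 1) + prob (?A 0) + prob (?A (-1))"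
    by (subst finite_measure_Union; (subst finite_measure_Union)?) auto
  then have "prob (?A 1 \<union> ?A 0 \<union> ?A (-1)) = 1" using p by simp
  then have "AE x in M. x \<in> ?A 1 \<union> ?A 0 \<union> ?A (-1)"
    by (subst (asm) prob_eq_1) auto
  then show ?thesis by eventually_elim auto
qed

lemma three_point_moment_fps:
  fixes Y :: "'a \<Rightarrow> real"
  assumes Y [measurable]: "Y \<in> borel_measurable M"
    and p: "prob {x \<in> space M. Y x = 1} = v / 2" "prob {x \<in> space M. Y x = 0} = 1 - v"
      "prob {x \<in> space M. Y x = -1} = v / 2"
  shows "moment_fps M Y = 1 + fps_const v * cosh_minus_one_fps"
proof (rule fps_ext)
  fix k
  let ?I = "\<lambda>c. indicat_real {x \<in> space M. Y x = c}"
  have int: "integrable M (?I c)" for c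
    by (intro integrable_real_indicator) (auto simp: emeasure_eq_measure)
  \<comment> \<open>The factor \<open>0 ^ k\<close> is 1 for \<open>k = 0\<close>, so the value 0
    contributes its mass to the zeroth moment only.\<close>
  have "expectation (\<lambda>x. Y x ^ k)
      = expectation (\<lambda>x. ?I 1 x + 0 ^ k * ?I 0 x + (-1) ^ k * ?I (-1) x)"
    using three_point_AE[OF Y p] AE_space
    by (intro integral_cong_AE) (auto simp: indicator_def)
  also have "\<dots> = v / 2 + 0 ^ k * (1 - v) + (-1) ^ k * (v / 2)"
    using int by (simp add: Int_absorb2 p)
  finally show "moment_fps M Y $ k = (1 + fps_const v * cosh_minus_one_fps) $ k"
    unfolding one_plus_cosh_nth moment_fps_nth by (auto simp: power_0_left)
qed

end

theorem lemma6:
  fixes M :: "'a measure" and N :: "'b measure"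
    and Z :: "nat \<Rightarrow> 'a \<Rightarrow> real" and Z' :: "nat \<Rightarrow> 'b \<Rightarrow> real"
    and n d :: nat and \<sigma> :: real
  assumes "prob_space M" and "prob_space N"
    and "n \<ge> 1"
    and "prob_space.indep_vars M (\<lambda>_. borel) Z {1..n}"
    and "\<And>i. i \<in> {1..n} \<Longrightarrow> symmetric_rv M (Z i)"
    and "\<And>i. i \<in> {1..n} \<Longrightarrow> AE x in M. Z i x \<in> {-1..1}"
    and "\<sigma>\<^sup>2 = (1 / real n) * (\<Sum>i=1..n. prob_space.variance M (Z i))"
    and "prob_space.indep_vars N (\<lambda>_. borel) Z' {1..n}"
    and "\<And>i. i \<in> {1..n} \<Longrightarrow> measure N {x \<in> space N. Z' i x = 1} = \<sigma>\<^sup>2 / 2"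
    and "\<And>i. i \<in> {1..n} \<Longrightarrow> measure N {x \<in> space N. Z' i x = 0} = 1 - \<sigma>\<^sup>2"
    and "\<And>i. i \<in> {1..n} \<Longrightarrow> measure N {x \<in> space N. Z' i x = -1} = \<sigma>\<^sup>2 / 2"
    and "d > 0" and "even d"
  shows "Lnorm M d (\<lambda>x. \<Sum>i=1..n. Z i x) \<le> Lnorm N d (\<lambda>x. \<Sum>i=1..n. Z' i x)"
proof -
  interpret M: prob_space M by fact
  interpret N: prob_space N by fact
  let ?F = "\<lambda>a. 1 + fps_const a * cosh_minus_one_fps"
  have measZ: "Z i \<in> borel_measurable M" if "i \<in> {1..n}" for i
    using assms(4) that by (auto simp: M.indep_vars_def)
  have measZ': "Z' i \<in> borel_measurable N" if "i \<in> {1..n}" for i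
    using assms(8) that by (auto simp: N.indep_vars_def)
  have bdZ: "AE x in M. \<bar>Z i x\<bar> \<le> 1" if "i \<in> {1..n}" for i
    using assms(6)[OF that] by eventually_elim auto
  \<comment> \<open>Boundedness comes from the three masses; it is what lets the series of the sum
    factor.\<close>
  have bdZ': "AE x in N. \<bar>Z' i x\<bar> \<le> 1" if "i \<in> {1..n}" for i
    using N.three_point_AE[OF measZ'[OF that] assms(9-11)[OF that]] by eventually_elim auto
  have var_sum: "(\<Sum>i=1..n. M.variance (Z i)) = real (card {1..n}) * \<sigma>\<^sup>2"
    using assms(3,7) by simp
  have "moment_fps M (\<lambda>x. \<Sum>i=1..n. Z i x) $ d = (\<Prod>i=1..n. moment_fps M (Z i)) $ d"
    using assms(4) bdZ by (subst M.moment_fps_sum) auto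
  also have "\<dots> \<le> (\<Prod>i=1..n. ?F (M.variance (Z i))) $ d"
    using M.symmetric_rv_moment_fps_nth[OF assms(5) measZ assms(6)]
    by (intro fps_prod_nth_mono) blast+
  \<comment> \<open>The variances are nonnegative with mean \<open>\<sigma>\<^sup>2\<close>, so
    averaging them applies.\<close>
  also have "\<dots> \<le> (?F (\<sigma>\<^sup>2) ^ card {1..n}) $ d"
    by (intro fps_prod_one_plus_nth_le_power var_sum integral_nonneg_AE)
       (auto simp: cosh_minus_one_fps_def)
  also have "?F (\<sigma>\<^sup>2) ^ card {1..n} = (\<Prod>i=1..n. moment_fps N (Z' i))"
    using N.three_point_moment_fps[OF measZ' assms(9-11)] by simp
  also have "\<dots> = moment_fps N (\<lambda>x. \<Sum>i=1..n. Z' i x)"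
    using assms(8) bdZ' by (subst N.moment_fps_sum) auto
  \<comment> \<open>Both coefficients carry the same factor 1 / d!. As \<open>d\<close> is even,
    these moments are the absolute ones, and the d-th root is monotone.\<close>
  finally have "M.expectation (\<lambda>x. (\<Sum>i=1..n. Z i x) ^ d) \<le> N.expectation (\<lambda>x. (\<Sum>i=1..n. Z' i x) ^ d)"
    by (simp add: divide_le_cancel)
  then show ?thesis
    unfolding Lnorm_def power_even_abs[OF \<open>even d\<close>]
    by (intro powr_mono2) (auto intro!: integral_nonneg_AE simp: zero_le_even_power[OF \<open>even d\<close>])
qed

end
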